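(* Let $f:\mathbb{R}^n\to\overline{\mathbb{R}}$ be a measurable function such that $f(x)\in\{0\}\cup[n,+\infty]$ for a.e. $x\in\mathbb{R}^n$. Then there exists a countable family $\{F_k\}_{k=1}^\infty$ of closed subsets of $\mathbb{R}^n$ such that $\lim_{k\to\infty}d_{F_k}(x)=f(x)$ for a.e. $x\in\mathbb{R}^n$.
   Context: $\mathcal{L}^n$ denotes the Lebesgue outer measure on $\mathbb{R}^n$; measurable and a.e. refer to Lebesgue measure; $\overline{\mathbb{R}}=[-\infty,+\infty]$; $B(x,r)$ is the open ball of radius $r$ centered at $x$. For $E\subset\mathbb{R}^n$ and $m\in[n,+\infty)$, $E^{(m)}$ denotes the set of $m$-density points of $E$, i.e. of those $x\in\mathbb{R}^n$ with $\lim_{r\to0^+}\mathcal{L}^n(B(x,r)\setminus E)/r^m=0$. The density-degree function $d_E:\mathbb{R}^n\to[0,+\infty]$ of $E$ is defined by $d_E(x):=\sup\{m\in[n,+\infty)\mid x\in E^{(m)}\}$ if $x\in E^{(n)}$, and $d_E(x):=0$ if $x\notin E^{(n)}$. *)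

theory Defs
  imports "HOL-Analysis.Analysis"
begin

text \<open>The Lebesgue outer measure is needed here because the set \<open>E\<close> may be nonmeasurable.\<close>

definition density_points :: "real \<Rightarrow> (real ^ 'n::finite) set \<Rightarrow> (real ^ 'n) set" where
  "density_points m E =
     {x. ((\<lambda>r. outer_measure_of lebesgue (ball x r - E) / ennreal (r powr m)) \<longlongrightarrow> 0)
           (at_right 0)}"

definition density_degree :: "(real ^ 'n::finite) set \<Rightarrow> real ^ 'n \<Rightarrow> ereal" where
  "density_degree E x =
     (if x \<in> density_points (real CARD('n)) E
      then Sup {ereal m | m. real CARD('n) \<le> m \<and> x \<in> density_points m E}
      else 0)"

end

theory Submission
  imports Defs
begin

text \<open>
  Write \<open>n\<close> for the dimension. The building block is an open set \<open>A\<close> that is removed from space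
  in order to bring the density degree at most points down to a number slightly below or equal to
  a given \<open>b > n\<close> (\<open>open_set_with_prescribed_degree\<close>). It is a union over a sequence of scales \<open>s\<close>,
  decreasing to \<open>0\<close>, of families of parallel slabs with spacing \<open>s\<close> and width \<open>s powr p\<close>, where
  \<open>p = b - n + 1\<close>. A ball whose radius is a suitable fixed multiple of \<open>s\<close> contains a piece of a
  slab of volume \<open>s powr p * s ^ (n - 1) = s powr b\<close>, hence the degree of the complement of \<open>A\<close> is
  nowhere above \<open>b\<close>.

  In the other direction, the points within distance \<open>s powr (1 + \<theta>)\<close> of the slabs of scale \<open>s\<close>
  have density of order \<open>s powr \<theta>\<close>, and the scales decrease so fast that these densities have a
  small sum. At any other point a ball of small radius \<open>r\<close> meets only slabs of scale less than
  \<open>r powr (1 / (1 + \<theta>))\<close>, and counting them shows that the volume of \<open>A\<close> in the ball is at most a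
  multiple of \<open>r powr ((p - \<theta>) / (1 + \<theta>) + n - 1)\<close>. This exponent tends to \<open>b\<close> as \<open>\<theta>\<close> tends to
  \<open>0\<close>. Since all slabs are perpendicular to one coordinate axis, the estimates reduce to volumes of
  boxes.

  The degree at a point depends only on the set near that point. Finitely many disjoint
  measurable sets \<open>E i\<close> are, up to small measure, disjoint closed sets, which have disjoint open
  neighbourhoods; removing a different open set \<open>A i\<close> inside each neighbourhood gives one closed
  set whose degree on most of \<open>E i\<close> is that of the complement of \<open>A i\<close> (\<open>glue_closed_set\<close>). With
  \<open>A i\<close> the whole space the degree is \<open>0\<close>.

  For each \<open>k\<close>, the points where \<open>f\<close> is at least \<open>n\<close> are sorted into finitely many classes by the
  value of \<open>min f (n + k)\<close>, in steps of \<open>1 / k\<close>; the previous constructions give a closed set whose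
  degree is within \<open>2 / k\<close> of this truncation on the ball of radius \<open>k\<close>, outside a set of small measure
  (\<open>closed_set_approximating_degree\<close>). If these measures have a finite sum, then by the
  Borel-Cantelli lemma almost every point lies in only finitely many exceptional sets, and at
  such a point the degrees converge to \<open>f\<close>. The value \<open>\<infinity>\<close> is reached through the truncations, and
  the value \<open>n\<close> from above.
\<close>

section \<open>Calculus of density points and of the density degree\<close>

lemma density_pointsI:
  fixes x :: "real ^ 'n::finite"
  assumes "m < e" and "0 < r0"
    and bound: "\<And>r. 0 < r \<Longrightarrow> r < r0 \<Longrightarrow> outer_measure_of lebesgue (ball x r - E) \<le> ennreal (C * r powr e)"
  shows "x \<in> density_points m E"
proof -
  have 1: "((\<lambda>r. ennreal (C * r powr (e - m))) \<longlongrightarrow> ennreal (C * 0)) (at_right 0)"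
  proof (intro tendsto_ennrealI tendsto_mult tendsto_const)
    have "((\<lambda>r. r powr (e - m)) \<longlongrightarrow> 0 powr (e - m)) (at_right (0::real))"
      using assms(1) by (intro tendsto_powr2) (auto intro: eventually_at_right_less eventually_mono simp: tendsto_ident_at)
    then show "((\<lambda>r. r powr (e - m)) \<longlongrightarrow> 0) (at_right (0::real))" by simp
  qed
  have 2: "\<forall>\<^sub>F r in at_right 0. outer_measure_of lebesgue (ball x r - E) / ennreal (r powr m)
             \<le> ennreal (C * r powr (e - m))"
    unfolding eventually_at_right_field
  proof (intro exI[of _ r0] conjI allI impI)
    fix r :: real assume r: "0 < r" "r < r0"
    have "outer_measure_of lebesgue (ball x r - E) / ennreal (r powr m)
            \<le> ennreal (C * r powr e) / ennreal (r powr m)"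
      by (intro divide_right_mono_ennreal bound r)
    also have "\<dots> = ennreal (C * r powr (e - m))"
    proof (cases "C \<ge> 0")
      case True
      then show ?thesis using r by (subst divide_ennreal) (auto simp: powr_diff)
    next
      case False
      then have "C * r powr e \<le> 0" "C * r powr (e - m) \<le> 0"
        by (auto intro!: mult_nonpos_nonneg)
      then show ?thesis by (simp add: ennreal_neg)
    qed
    finally show "outer_measure_of lebesgue (ball x r - E) / ennreal (r powr m)
             \<le> ennreal (C * r powr (e - m))" .
  qed (use assms in auto)
  show ?thesis
    unfolding density_points_def mem_Collect_eq
    using 1 2 by (intro tendsto_sandwich[OF _ 2 tendsto_const]) auto
qed

text \<open>
  Failure along a single sequence of radii is enough, so sets that are large only at selected scales
  can be treated.
\<close>

lemma not_density_pointsI: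
  fixes x :: "real ^ 'n::finite"
  assumes "0 < c" and r: "r \<longlonglongrightarrow> 0" "\<And>k. 0 < r k"
    and bound: "\<And>k. ennreal (c * r k powr m) \<le> outer_measure_of lebesgue (ball x (r k) - E)"
  shows "x \<notin> density_points m E"
proof
  assume "x \<in> density_points m E"
  moreover have "filterlim r (at_right 0) sequentially"
    using r unfolding filterlim_at by (auto intro!: always_eventually simp: less_imp_neq[THEN not_sym])
  ultimately have "(\<lambda>k. outer_measure_of lebesgue (ball x (r k) - E) / ennreal (r k powr m)) \<longlonglongrightarrow> 0"
    unfolding density_points_def by (auto intro: filterlim_compose)
  moreover have "ennreal c \<le> outer_measure_of lebesgue (ball x (r k) - E) / ennreal (r k powr m)" for k
  proof -
    have "ennreal c = ennreal (c * r k powr m) / ennreal (r k powr m)"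
      using assms(1) r(2)[of k] by (subst divide_ennreal) auto
    also have "\<dots> \<le> outer_measure_of lebesgue (ball x (r k) - E) / ennreal (r k powr m)"
      by (intro divide_right_mono_ennreal bound)
    finally show ?thesis .
  qed
  ultimately have "ennreal c \<le> 0" by (intro LIMSEQ_le_const) auto
  with \<open>0 < c\<close> show False by simp
qed

lemma density_points_local:
  fixes x :: "real ^ 'n::finite"
  assumes "open V" "x \<in> V" "V - E = V - E'" "x \<in> density_points m E"
  shows "x \<in> density_points m E'"
proof -
  obtain d where d: "0 < d" "ball x d \<subseteq> V" using assms(1,2) open_contains_ball by blast
  have "\<forall>\<^sub>F r in at_right 0. ball x r - E = ball x r - E'"
    unfolding eventually_at_right_field
  proof (intro exI[of _ d] conjI allI impI)
    fix r assume "r < d"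
    then have "ball x r \<subseteq> V" using d by (auto simp: subset_eq)
    then show "ball x r - E = ball x r - E'" using assms(3) by blast
  qed (use d in auto)
  then have "\<forall>\<^sub>F r in at_right 0. outer_measure_of lebesgue (ball x r - E) / ennreal (r powr m)
      = outer_measure_of lebesgue (ball x r - E') / ennreal (r powr m)"
    by eventually_elim simp
  from tendsto_cong[OF this] show ?thesis using assms(4) unfolding density_points_def by simp
qed

text \<open>
  The defining limit only involves arbitrarily small balls around the point.
\<close>

lemma density_degree_local:
  fixes x :: "real ^ 'n::finite"
  assumes "open V" "x \<in> V" "V - E = V - E'"
  shows "density_degree E x = density_degree E' x"
proof -
  have "x \<in> density_points m E \<longleftrightarrow> x \<in> density_points m E'" for m
    using density_points_local[OF assms(1,2)] assms(3) by metis
  then show ?thesis unfolding density_degree_def by simp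
qed

lemma density_degree_empty: "density_degree {} (x :: real ^ 'n::finite) = 0"
proof -
  have "x \<notin> density_points (real CARD('n)) {}"
  proof (rule not_density_pointsI)
    show "0 < unit_ball_vol (real CARD('n))" by simp
    show "(\<lambda>k. inverse (real (Suc k))) \<longlonglongrightarrow> 0" by (rule LIMSEQ_inverse_real_of_nat)
    show "ennreal (unit_ball_vol (real CARD('n)) * inverse (real (Suc k)) powr real CARD('n))
         \<le> outer_measure_of lebesgue (ball x (inverse (real (Suc k))) - {})" for k
      by (simp add: emeasure_ball powr_realpow[symmetric] del: of_nat_Suc)
  qed auto
  then show ?thesis by (simp add: density_degree_def)
qed

lemma density_degree_between:
  fixes x :: "real ^ 'n::finite"
  assumes "real CARD('n) \<le> a" "x \<in> density_points (real CARD('n)) E" "x \<in> density_points a E"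
    and "\<And>m. b \<le> m \<Longrightarrow> x \<notin> density_points m E"
  shows "ereal a \<le> density_degree E x \<and> density_degree E x \<le> ereal b"
proof -
  have "ereal a \<le> Sup {ereal m | m. real CARD('n) \<le> m \<and> x \<in> density_points m E}"
    using assms by (intro Sup_upper) auto
  moreover have "Sup {ereal m | m. real CARD('n) \<le> m \<and> x \<in> density_points m E} \<le> ereal b"
    using assms(4) by (intro Sup_least) (fastforce intro: less_imp_le simp: not_le[symmetric])
  ultimately show ?thesis using assms(2) by (simp add: density_degree_def)
qed

section \<open>Periodic families of slabs\<close>

lemma emeasure_box_one_side:
  fixes c :: "real ^ 'n::finite"
  assumes "l \<le> u" "0 \<le> t"
  shows "emeasure lebesgue (cbox (\<chi> j. if j = i then l else c $ j) (\<chi> j. if j = i then u else c $ j + t))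
          = ennreal ((u - l) * t ^ (CARD('n) - 1))"
proof -
  let ?a = "(\<chi> j. if j = i then l else c $ j)" and ?b = "(\<chi> j. if j = i then u else c $ j + t)"
  have ne: "cbox ?a ?b \<noteq> {}" using assms by (auto simp: interval_ne_empty_cart)
  have "measure lebesgue (cbox ?a ?b) = (\<Prod>j\<in>UNIV. ?b $ j - ?a $ j)"
    using content_cbox_cart[OF ne] by simp
  also have "\<dots> = (?b $ i - ?a $ i) * (\<Prod>j\<in>UNIV - {i}. ?b $ j - ?a $ j)"
    by (rule prod.remove) auto
  also have "(\<Prod>j\<in>UNIV - {i}. ?b $ j - ?a $ j) = (\<Prod>j\<in>UNIV - {i}. t)"
    by (rule prod.cong) auto
  finally have "measure lebesgue (cbox ?a ?b) = (u - l) * t ^ (CARD('n) - 1)"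
    by (simp add: card_Diff_singleton)
  then show ?thesis by (simp add: emeasure_eq_ennreal_measure lmeasurable_cbox fmeasurableD2)
qed

lemma card_int_between:
  fixes \<alpha> \<beta> :: real
  assumes "\<alpha> \<le> \<beta>"
  shows "finite {k::int. \<alpha> < k \<and> k < \<beta>}" "real (card {k::int. \<alpha> < k \<and> k < \<beta>}) \<le> \<beta> - \<alpha> + 1"
proof -
  have sub: "{k::int. \<alpha> < k \<and> k < \<beta>} \<subseteq> {\<lfloor>\<alpha>\<rfloor> + 1..\<lceil>\<beta>\<rceil> - 1}"
    by (auto; linarith)
  then show "finite {k::int. \<alpha> < k \<and> k < \<beta>}" by (rule finite_subset) simp
  have "card {k::int. \<alpha> < k \<and> k < \<beta>} \<le> card {\<lfloor>\<alpha>\<rfloor> + 1..\<lceil>\<beta>\<rceil> - 1}"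
    by (rule card_mono[OF _ sub]) simp
  then show "real (card {k::int. \<alpha> < k \<and> k < \<beta>}) \<le> \<beta> - \<alpha> + 1"
    using assms by (simp; linarith)
qed

text \<open>
  The spacing \<open>s\<close>, the left end \<open>l\<close> and the right end \<open>u\<close> are separate parameters so that the enlargement
  of every interval by \<open>\<rho>\<close> on both sides is again of this form, with ends \<open>l - \<rho>\<close> and \<open>u + \<rho>\<close>.
\<close>

definition grid :: "real \<Rightarrow> real \<Rightarrow> real \<Rightarrow> real set" where
  "grid s l u = (\<Union>k::int. {of_int k * s + l <..< of_int k * s + u})"

lemma open_grid: "open (grid s l u)"
  unfolding grid_def by auto

lemma open_slab: "open T \<Longrightarrow> open {y :: real ^ 'n::finite. y $ i \<in> T}"
  using open_vimage[of T "\<lambda>y. y $ i"] by (simp add: vimage_def continuous_on_component)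

text \<open>
  At most \<open>(t + (u - l)) / s + 1\<close> of the intervals meet the side of the cube perpendicular to the slabs, and
  each contributes a box.
\<close>

lemma emeasure_grid_slab:
  fixes c :: "real ^ 'n::finite"
  assumes "0 < s" "l \<le> u" "0 \<le> t"
  shows "emeasure lebesgue {y. (\<forall>j. c $ j \<le> y $ j \<and> y $ j \<le> c $ j + t) \<and> y $ i \<in> grid s l u}
     \<le> ennreal (((t + (u - l)) / s + 1) * ((u - l) * t ^ (CARD('n) - 1)))"
proof -
  define K where "K = {k::int. (c $ i - u) / s < k \<and> k < (c $ i + t - l) / s}"
  define B where "B k = cbox (\<chi> j. if j = i then of_int k * s + l else c $ j)
      (\<chi> j. if j = i then of_int k * s + u else c $ j + t)" for k :: int
  have le: "(c $ i - u) / s \<le> (c $ i + t - l) / s" using assms by (intro divide_right_mono) auto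
  have K: "finite K" "real (card K) \<le> (t + (u - l)) / s + 1"
    using card_int_between[OF le] assms unfolding K_def by (auto simp: diff_divide_distrib add_divide_distrib)
  have "{y. (\<forall>j. c $ j \<le> y $ j \<and> y $ j \<le> c $ j + t) \<and> y $ i \<in> grid s l u} \<subseteq> (\<Union>k\<in>K. B k)"
  proof
    fix y assume "y \<in> {y. (\<forall>j. c $ j \<le> y $ j \<and> y $ j \<le> c $ j + t) \<and> y $ i \<in> grid s l u}"
    then obtain k :: int where y: "\<And>j. c $ j \<le> y $ j \<and> y $ j \<le> c $ j + t"
      and k: "of_int k * s + l < y $ i" "y $ i < of_int k * s + u" by (auto simp: grid_def)
    have "k \<in> K" using y[of i] k assms unfolding K_def by (auto simp: field_simps)
    moreover have "y \<in> B k" using y k unfolding B_def by (auto simp: mem_box_cart)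
    ultimately show "y \<in> (\<Union>k\<in>K. B k)" by blast
  qed
  then have "emeasure lebesgue {y. (\<forall>j. c $ j \<le> y $ j \<and> y $ j \<le> c $ j + t) \<and> y $ i \<in> grid s l u}
      \<le> emeasure lebesgue (\<Union>k\<in>K. B k)"
    using K by (intro emeasure_mono) (auto simp: B_def intro!: sets.finite_UN)
  also have "\<dots> \<le> (\<Sum>k\<in>K. emeasure lebesgue (B k))"
    using K by (intro emeasure_subadditive_finite) (auto simp: B_def)
  also have "\<dots> = (\<Sum>k\<in>K. ennreal ((u - l) * t ^ (CARD('n) - 1)))"
    unfolding B_def using assms by (subst emeasure_box_one_side) auto
  also have "\<dots> = ennreal (real (card K) * ((u - l) * t ^ (CARD('n) - 1)))"
    using assms by (subst sum_ennreal) auto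
  also have "\<dots> \<le> ennreal (((t + (u - l)) / s + 1) * ((u - l) * t ^ (CARD('n) - 1)))"
    using K assms by (intro ennreal_leI mult_right_mono) auto
  finally show ?thesis .
qed

definition slabs :: "'n::finite \<Rightarrow> real \<Rightarrow> real \<Rightarrow> real \<Rightarrow> (real ^ 'n) set" where
  "slabs i s l u = {y. y $ i \<in> grid s l u}"

lemma open_slabs: "open (slabs i s l u)"
  unfolding slabs_def by (intro open_slab open_grid)

lemma sets_slabs [measurable, simp]: "slabs i s l u \<in> sets lebesgue"
  using borel_open[OF open_slabs] by (intro sets_completionI_sets) simp

lemma ball_subset_cube: "ball x r \<subseteq> {y. \<forall>j. (x - (\<chi> j. r)) $ j \<le> y $ j \<and> y $ j \<le> (x - (\<chi> j. r)) $ j + 2 * r}"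
proof safe
  fix y j assume "y \<in> ball x r"
  then have "\<bar>(x - y) $ j\<bar> < r" using component_le_norm_cart[of "x - y" j] by (simp add: dist_norm)
  then show "(x - (\<chi> j. r)) $ j \<le> y $ j" "y $ j \<le> (x - (\<chi> j. r)) $ j + 2 * r" by auto
qed

text \<open>
  The estimate at a single scale \<open>s\<close>. A point outside the enlarged slabs has distance at least \<open>s powr (1 + \<theta>)\<close>
  from the slabs, so balls of smaller radius do not meet them. For larger \<open>r\<close>, both \<open>r\<close> and \<open>s\<close> are
  at most \<open>\<sigma> = r powr (1 / (1 + \<theta>))\<close>; about \<open>\<sigma> / s\<close> slabs are met, with total volume about
  \<open>\<sigma> * s powr (p - 1) * r ^ (n - 1)\<close>. Of the power \<open>p - 1\<close> of \<open>s\<close>, the part \<open>\<theta>\<close> is kept to make the sum over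
  all scales converge, and the rest is bounded by the same power of \<open>\<sigma>\<close>.
\<close>

lemma emeasure_ball_Int_slabs_le:
  fixes x :: "real ^ 'n::finite"
  assumes \<theta>: "0 < \<theta>" "\<theta> \<le> p - 1" and s: "0 < s" "s \<le> 1" and r: "0 < r" "r \<le> 1"
    and x: "x \<notin> slabs i s (- (s powr (1 + \<theta>))) (s powr p + s powr (1 + \<theta>))"
  shows "emeasure lebesgue (ball x r \<inter> slabs i s 0 (s powr p))
    \<le> ennreal (4 * 2 ^ (CARD('n) - 1) * r powr ((p - \<theta>) / (1 + \<theta>) + real (CARD('n) - 1)) * s powr \<theta>)"
proof (cases "r \<le> s powr (1 + \<theta>)")
  case True
  have "ball x r \<inter> slabs i s 0 (s powr p) = {}"
  proof (safe; simp)
    fix y assume y: "dist x y < r" "y \<in> slabs i s 0 (s powr p)"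
    then obtain k :: int where k: "of_int k * s < y $ i" "y $ i < of_int k * s + s powr p"
      by (auto simp: slabs_def grid_def)
    have "\<bar>(x - y) $ i\<bar> < r" using y component_le_norm_cart[of "x - y" i] by (simp add: dist_norm)
    then have "x $ i \<in> {of_int k * s - s powr (1 + \<theta>) <..< of_int k * s + (s powr p + s powr (1 + \<theta>))}"
      using k True by auto
    then have "x \<in> slabs i s (- (s powr (1 + \<theta>))) (s powr p + s powr (1 + \<theta>))"
      by (auto simp: slabs_def grid_def)
    then show False using x by simp
  qed
  then show ?thesis by simp
next
  case False
  define \<sigma> where "\<sigma> = r powr (1 / (1 + \<theta>))"
  have \<sigma>: "0 < \<sigma>" "r \<le> \<sigma>" "s \<le> \<sigma>" "\<sigma> powr (p - \<theta>) = r powr ((p - \<theta>) / (1 + \<theta>))"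
  proof -
    show "0 < \<sigma>" using r by (simp add: \<sigma>_def)
    have "r powr 1 \<le> r powr (1 / (1 + \<theta>))" using r \<theta> by (intro powr_mono') auto
    then show "r \<le> \<sigma>" using r by (simp add: \<sigma>_def)
    have "(s powr (1 + \<theta>)) powr (1 / (1 + \<theta>)) \<le> \<sigma>" unfolding \<sigma>_def
      using False s \<theta> by (intro powr_mono2) auto
    then show "s \<le> \<sigma>" using s \<theta> by (simp add: powr_powr)
    show "\<sigma> powr (p - \<theta>) = r powr ((p - \<theta>) / (1 + \<theta>))" by (simp add: \<sigma>_def powr_powr)
  qed
  have w: "s powr p \<le> s" using powr_mono'[of 1 p s] s \<theta> by simp
  let ?c = "x - (\<chi> j. r)"
  have "emeasure lebesgue (ball x r \<inter> slabs i s 0 (s powr p))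
     \<le> emeasure lebesgue {y. (\<forall>j. ?c $ j \<le> y $ j \<and> y $ j \<le> ?c $ j + 2 * r) \<and> y $ i \<in> grid s 0 (s powr p)}"
  proof (rule emeasure_mono)
    show "ball x r \<inter> slabs i s 0 (s powr p) \<subseteq>
        {y. (\<forall>j. ?c $ j \<le> y $ j \<and> y $ j \<le> ?c $ j + 2 * r) \<and> y $ i \<in> grid s 0 (s powr p)}"
      using ball_subset_cube[of x r] by (auto simp: slabs_def subset_eq)
    have "{y. (\<forall>j. ?c $ j \<le> y $ j \<and> y $ j \<le> ?c $ j + 2 * r) \<and> y $ i \<in> grid s 0 (s powr p)}
      = cbox ?c (\<chi> j. ?c $ j + 2 * r) \<inter> slabs i s 0 (s powr p)"
      by (auto simp: slabs_def mem_box_cart)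
    moreover have "cbox ?c (\<chi> j. ?c $ j + 2 * r) \<in> sets lebesgue"
      by (intro fmeasurableD lmeasurable_cbox)
    ultimately show "{y. (\<forall>j. ?c $ j \<le> y $ j \<and> y $ j \<le> ?c $ j + 2 * r) \<and> y $ i \<in> grid s 0 (s powr p)} \<in> sets lebesgue"
      by (simp only: sets.Int sets_slabs)
  qed
  also have "\<dots> \<le> ennreal (((2 * r + s powr p) / s + 1) * (s powr p * (2 * r) ^ (CARD('n) - 1)))"
    using emeasure_grid_slab[of s 0 "s powr p" "2 * r" ?c i] s r by simp
  also have "\<dots> \<le> ennreal ((4 * \<sigma> / s) * (s powr p * (2 * r) ^ (CARD('n) - 1)))"
  proof (intro ennreal_leI mult_right_mono)
    have "(2 * r + s powr p + s) / s \<le> 4 * \<sigma> / s" using \<sigma> w s by (intro divide_right_mono) auto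
    then show "(2 * r + s powr p) / s + 1 \<le> 4 * \<sigma> / s" using s by (simp add: add_divide_distrib)
  qed (use r in auto)
  also have "(4 * \<sigma> / s) * (s powr p * (2 * r) ^ (CARD('n) - 1))
      = 4 * 2 ^ (CARD('n) - 1) * r ^ (CARD('n) - 1) * (\<sigma> * s powr (p - 1 - \<theta>)) * s powr \<theta>"
  proof -
    have "s powr p / s = s powr (p - 1 - \<theta>) * s powr \<theta>"
      using s powr_add[of s "p - 1 - \<theta>" \<theta>] powr_diff[of s p 1] by simp
    then have "s powr p = s powr (p - 1 - \<theta>) * s powr \<theta> * s" using s by (simp add: field_simps)
    then show ?thesis using s by (simp add: power_mult_distrib field_simps)
  qed
  also have "ennreal \<dots> \<le> ennreal (4 * 2 ^ (CARD('n) - 1) * r ^ (CARD('n) - 1) * (\<sigma> * \<sigma> powr (p - 1 - \<theta>)) * s powr \<theta>)"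
    using s \<sigma> \<theta> r by (intro ennreal_leI mult_right_mono mult_left_mono powr_mono2) auto
  also have "\<sigma> * \<sigma> powr (p - 1 - \<theta>) = r powr ((p - \<theta>) / (1 + \<theta>))"
    using \<sigma>(1) powr_add[of \<sigma> 1 "p - 1 - \<theta>"] by (simp add: \<sigma>(4)[symmetric])
  also have "4 * 2 ^ (CARD('n) - 1) * r ^ (CARD('n) - 1) * r powr ((p - \<theta>) / (1 + \<theta>)) * s powr \<theta>
     = 4 * 2 ^ (CARD('n) - 1) * r powr ((p - \<theta>) / (1 + \<theta>) + real (CARD('n) - 1)) * s powr \<theta>"
    using r powr_realpow[of r "CARD('n) - 1"] by (simp only: powr_add mult_ac)
  finally show ?thesis .
qed

text \<open>
  The points that the previous estimate excludes: slabs of width at most \<open>3 * s powr (1 + \<theta>)\<close> with spacing \<open>s\<close>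
  have density of order \<open>s powr \<theta>\<close>.
\<close>

lemma emeasure_slabs_enlarged_le:
  assumes \<theta>: "0 < \<theta>" "\<theta> \<le> p - 1" and s: "0 < s" "s \<le> 1" and R: "0 < R"
  shows "emeasure lebesgue ({y :: real ^ 'n::finite. \<forall>j. - R \<le> y $ j \<and> y $ j \<le> R} \<inter>
      slabs i s (- (s powr (1 + \<theta>))) (s powr p + s powr (1 + \<theta>)))
    \<le> ennreal ((2 * R + 4) * 3 * (2 * R) ^ (CARD('n) - 1) * s powr \<theta>)"
proof -
  let ?c = "(\<chi> j. - R) :: real ^ 'n" and ?\<rho> = "s powr (1 + \<theta>)" and ?w = "s powr p"
  have \<rho>: "?w \<le> ?\<rho>" "?\<rho> \<le> s" "?\<rho> = s * s powr \<theta>"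
    using powr_mono'[of "1 + \<theta>" p s] powr_mono'[of 1 "1 + \<theta>" s] s \<theta> by (auto simp: powr_add)
  have eq: "{y :: real ^ 'n. \<forall>j. - R \<le> y $ j \<and> y $ j \<le> R} \<inter> slabs i s (- ?\<rho>) (?w + ?\<rho>)
     = {y. (\<forall>j. ?c $ j \<le> y $ j \<and> y $ j \<le> ?c $ j + 2 * R) \<and> y $ i \<in> grid s (- ?\<rho>) (?w + ?\<rho>)}"
    by (auto simp: slabs_def)
  have "emeasure lebesgue ({y :: real ^ 'n. \<forall>j. - R \<le> y $ j \<and> y $ j \<le> R} \<inter> slabs i s (- ?\<rho>) (?w + ?\<rho>))
     \<le> ennreal (((2 * R + ((?w + ?\<rho>) - (- ?\<rho>))) / s + 1) * (((?w + ?\<rho>) - (- ?\<rho>)) * (2 * R) ^ (CARD('n) - 1)))"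
    unfolding eq using s R by (intro emeasure_grid_slab) auto
  also have "\<dots> \<le> ennreal (((2 * R + 4) / s) * ((3 * ?\<rho>) * (2 * R) ^ (CARD('n) - 1)))"
  proof (intro ennreal_leI mult_mono)
    have "2 * R + ((?w + ?\<rho>) - (- ?\<rho>)) + s \<le> 2 * R + 4"
      using \<rho>(1,2) s(2) by linarith
    then have "(2 * R + ((?w + ?\<rho>) - (- ?\<rho>)) + s) / s \<le> (2 * R + 4) / s"
      using s by (intro divide_right_mono) auto
    then show "(2 * R + ((?w + ?\<rho>) - (- ?\<rho>))) / s + 1 \<le> (2 * R + 4) / s" using s by (simp add: add_divide_distrib)
    show "?w + ?\<rho> - - ?\<rho> \<le> 3 * ?\<rho>" using \<rho> by simp
  qed (use R s in auto)
  also have "((2 * R + 4) / s) * ((3 * ?\<rho>) * (2 * R) ^ (CARD('n) - 1))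
      = (2 * R + 4) * 3 * (2 * R) ^ (CARD('n) - 1) * s powr \<theta>"
    using s by (simp add: \<rho>(3))
  finally show ?thesis .
qed

text \<open>
  In the direction across the slabs one of them starts within distance \<open>s\<close> of \<open>x\<close>, so the ball of
  radius \<open>3 n s\<close> contains a box in this slab with one side \<open>s powr p\<close> and the others \<open>s\<close>.
\<close>

lemma not_density_points_slabs:
  fixes x :: "real ^ 'n::finite"
  assumes p: "1 \<le> p" and s: "\<And>j. 0 < s j" "\<And>j. s j \<le> 1" "s \<longlonglongrightarrow> 0"
    and A: "\<And>j. slabs i (s j) 0 (s j powr p) \<subseteq> A" "A \<in> sets lebesgue"
    and m: "p + real (CARD('n) - 1) \<le> m"
  shows "x \<notin> density_points m (- A)"
proof (rule not_density_pointsI)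
  let ?n = "real CARD('n)"
  have n: "0 < ?n" by simp
  show "0 < (3 * ?n) powr (- m)" using n by (simp del: of_nat_0_less_iff)
  show "(\<lambda>j. 3 * ?n * s j) \<longlonglongrightarrow> 0" using tendsto_mult_left[OF s(3), of "3 * ?n"] by simp
  show "0 < 3 * ?n * s j" for j using s(1)[of j] by simp
  show "ennreal ((3 * ?n) powr (- m) * (3 * ?n * s j) powr m) \<le> outer_measure_of lebesgue (ball x (3 * ?n * s j) - - A)" for j
  proof -
    let ?s = "s j" and ?w = "s j powr p"
    have w: "?w \<le> ?s" using powr_mono'[of 1 p ?s] s(1,2)[of j] p by simp
    define k where "k = \<lceil>x $ i / ?s\<rceil>"
    have k: "x $ i \<le> of_int k * ?s" "of_int k * ?s \<le> x $ i + ?s"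
    proof -
      have "x $ i / ?s \<le> of_int k" "of_int k \<le> x $ i / ?s + 1" unfolding k_def by linarith+
      then show "x $ i \<le> of_int k * ?s" "of_int k * ?s \<le> x $ i + ?s"
        using s(1)[of j] by (simp_all add: field_simps)
    qed
    define a b where "a = (\<chi> l. if l = i then of_int k * ?s else x $ l)"
      and "b = (\<chi> l. if l = i then of_int k * ?s + ?w else x $ l + ?s)"
    have sub: "box a b \<subseteq> ball x (3 * ?n * ?s) - - A"
    proof
      fix y assume y: "y \<in> box a b"
      then have yi: "of_int k * ?s < y $ i" "y $ i < of_int k * ?s + ?w"
        by (auto simp: mem_box_cart a_def b_def dest: spec[of _ i])
      then have "y \<in> A" using A(1)[of j] by (auto simp: slabs_def grid_def)
      have "\<bar>(x - y) $ l\<bar> \<le> 2 * ?s" for l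
      proof (cases "l = i")
        case True
        then show ?thesis using yi k w by auto
      next
        case False
        then have "x $ l < y $ l" "y $ l < x $ l + ?s"
          using y by (auto simp: mem_box_cart a_def b_def dest: spec[of _ l])
        then show ?thesis by auto
      qed
      then have "(\<Sum>l\<in>UNIV. \<bar>(x - y) $ l\<bar>) \<le> (\<Sum>l\<in>(UNIV::'n set). 2 * ?s)" by (intro sum_mono)
      then have "norm (x - y) \<le> ?n * (2 * ?s)" using norm_le_l1_cart[of "x - y"] by simp
      also have "\<dots> < 3 * ?n * ?s" using s(1)[of j] n by simp
      finally show "y \<in> ball x (3 * ?n * ?s) - - A" using \<open>y \<in> A\<close> by (simp add: dist_norm)
    qed
    have "(3 * ?n) powr (- m) * (3 * ?n * ?s) powr m = ?s powr m"
      using s(1)[of j] n powr_mult[of "3 * ?n" ?s m] by (simp add: powr_minus)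
    also have "\<dots> \<le> ?s powr (p + real (CARD('n) - 1))"
      using s m by (intro powr_mono') (auto intro: less_imp_le)
    also have "\<dots> = (of_int k * ?s + ?w - of_int k * ?s) * ?s ^ (CARD('n) - 1)"
      using s(1)[of j] powr_realpow[of ?s "CARD('n) - 1"] by (simp only: powr_add add_diff_cancel_left')
    finally have "ennreal ((3 * ?n) powr (- m) * (3 * ?n * ?s) powr m)
        \<le> ennreal ((of_int k * ?s + ?w - of_int k * ?s) * ?s ^ (CARD('n) - 1))" by (rule ennreal_leI)
    also have "\<dots> = emeasure lebesgue (cbox a b)"
      unfolding a_def b_def using s(1)[of j] by (subst emeasure_box_one_side) auto
    also have "\<dots> = emeasure lebesgue (box a b)" by (simp add: emeasure_lborel_cbox_eq emeasure_lborel_box_eq)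
    also have "\<dots> \<le> emeasure lebesgue (ball x (3 * ?n * ?s) - - A)"
      using A(2) by (intro emeasure_mono sub) auto
    also have "\<dots> = outer_measure_of lebesgue (ball x (3 * ?n * ?s) - - A)"
      using A(2) by (intro outer_measure_of_eq[symmetric]) auto
    finally show ?thesis .
  qed
qed

section \<open>Open sets whose complement has a prescribed degree\<close>

text \<open>
  The slack between \<open>a\<close> and \<open>b\<close> absorbs the loss in the exponent that comes with a fixed \<open>\<theta> > 0\<close>.
\<close>

lemma open_set_with_prescribed_degree:
  fixes a b R \<epsilon> :: real
  assumes ab: "real CARD('n) < a" "a < b" and R: "0 < R" and \<epsilon>: "0 < \<epsilon>"
  obtains A N :: "(real ^ 'n::finite) set" where "open A" "N \<in> sets lebesgue"
    "emeasure lebesgue N \<le> ennreal \<epsilon>"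
    "\<And>x. norm x \<le> R \<Longrightarrow> x \<notin> N \<Longrightarrow>
      ereal a \<le> density_degree (- A) x \<and> density_degree (- A) x \<le> ereal b"
proof -
  fix i :: 'n
  define n where "n = real CARD('n)"
  have n1: "real (CARD('n) - 1) = n - 1" by (simp add: n_def of_nat_diff)
  define p where "p = b - n + 1"
  \<comment> \<open>The second bound makes \<open>(p - \<theta>) / (1 + \<theta>)\<close> exceed \<open>a - n + 1\<close>, so that the volume bound
     beats the exponent \<open>a\<close>; the first keeps the slabs narrower than their enlargement.\<close>
  define \<theta> where "\<theta> = min (p - 1) ((b - a) / (2 + (a - n + 1)))"
  have a': "0 < 2 + (a - n + 1)" using ab by (simp add: n_def)
  have \<theta>: "0 < \<theta>" "\<theta> \<le> p - 1" "\<theta> \<le> (b - a) / (2 + (a - n + 1))"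
    using ab a' unfolding \<theta>_def p_def by (auto simp: n_def)
  have e: "a < (p - \<theta>) / (1 + \<theta>) + real (CARD('n) - 1)"
  proof -
    have "\<theta> * (2 + (a - n + 1)) \<le> b - a" using \<theta>(3) a' by (simp add: pos_le_divide_eq)
    then have "(a - n + 1) * (1 + \<theta>) < p - \<theta>" using \<theta>(1) unfolding p_def by (simp add: algebra_simps)
    then have "a - n + 1 < (p - \<theta>) / (1 + \<theta>)" using \<theta>(1) by (simp add: pos_less_divide_eq)
    then show ?thesis unfolding n1 by simp
  qed
  \<comment> \<open>The constant in \<open>emeasure_slabs_enlarged_le\<close>; the scales below are such that these bounds
     sum to \<open>C * \<eta> \<le> \<epsilon>\<close>.\<close>
  define C where "C = (2 * R + 4) * 3 * (2 * R) ^ (CARD('n) - 1)"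
  have C: "0 < C" using R by (simp add: C_def)
  define \<eta> where "\<eta> = min 1 (\<epsilon> / C)"
  have \<eta>: "0 < \<eta>" "\<eta> \<le> 1" "C * \<eta> \<le> \<epsilon>"
    using \<epsilon> C by (auto simp: \<eta>_def min_def field_simps)
  define s where "s j = (\<eta> * (1 / 2) ^ Suc j) powr (1 / \<theta>)" for j :: nat
  have half: "\<eta> * (1 / 2) ^ Suc j \<le> 1" for j
    using mult_mono[of \<eta> 1 "(1 / 2) ^ Suc j" 1] \<eta> by (simp add: power_le_one del: power_Suc)
  have s: "0 < s j" "s j \<le> 1" "s j powr \<theta> = \<eta> * (1 / 2) ^ Suc j" for j
  proof -
    show "0 < s j" using \<eta> by (simp add: s_def)
    show "s j \<le> 1" unfolding s_def using half[of j] \<eta> \<theta> by (intro powr_le1) auto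
    show "s j powr \<theta> = \<eta> * (1 / 2) ^ Suc j" unfolding s_def using \<theta> \<eta> by (simp add: powr_powr)
  qed
  have sum: "(\<lambda>j. s j powr \<theta>) sums \<eta>"
    unfolding s(3) using sums_mult[OF power_half_series, of \<eta>] by simp
  have s0: "s \<longlonglongrightarrow> 0"
  proof -
    have "(\<lambda>j. (s j powr \<theta>) powr (1 / \<theta>)) \<longlonglongrightarrow> 0 powr (1 / \<theta>)"
      using sums_summable[OF sum, THEN summable_LIMSEQ_zero] \<theta> by (intro tendsto_powr2) auto
    then show ?thesis using \<theta> s(1) by (simp add: powr_powr less_imp_le)
  qed
  define A where "A = (\<Union>j. slabs i (s j) 0 (s j powr p))"
  define M where "M j = {y :: real ^ 'n. \<forall>l. - R \<le> y $ l \<and> y $ l \<le> R} \<inter>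
      slabs i (s j) (- (s j powr (1 + \<theta>))) (s j powr p + s j powr (1 + \<theta>))" for j
  define N where "N = (\<Union>j. M j)"
  have "open A" unfolding A_def by (intro open_UN ballI open_slabs)
  then have A: "A \<in> sets lebesgue" by (auto intro: borel_open)
  have "{y :: real ^ 'n. \<forall>l. - R \<le> y $ l \<and> y $ l \<le> R} = cbox (\<chi> l. - R) (\<chi> l. R)"
    by (auto simp: mem_box_cart)
  then have "{y :: real ^ 'n. \<forall>l. - R \<le> y $ l \<and> y $ l \<le> R} \<in> sets lebesgue"
    using fmeasurableD[OF lmeasurable_cbox] by metis
  then have M: "M j \<in> sets lebesgue" for j unfolding M_def by (intro sets.Int sets_slabs)
  have N: "N \<in> sets lebesgue" unfolding N_def using M by auto
  have "emeasure lebesgue N \<le> (\<Sum>j. emeasure lebesgue (M j))"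
    unfolding N_def using M by (intro emeasure_subadditive_countably) auto
  also have "\<dots> \<le> (\<Sum>j. ennreal (C * s j powr \<theta>))"
    unfolding M_def C_def using s \<theta> R by (intro suminf_le emeasure_slabs_enlarged_le) auto
  also have "\<dots> = ennreal (C * \<eta>)"
    using C by (intro suminf_ennreal_eq sums_mult sum) auto
  also have "\<dots> \<le> ennreal \<epsilon>" using \<eta> by (intro ennreal_leI)
  finally have N\<epsilon>: "emeasure lebesgue N \<le> ennreal \<epsilon>" .
  have deg: "ereal a \<le> density_degree (- A) x \<and> density_degree (- A) x \<le> ereal b"
    if x: "norm x \<le> R" "x \<notin> N" for x
  proof -
    have "\<bar>x $ l\<bar> \<le> R" for l using component_le_norm_cart[of x l] x by simp
    then have "\<forall>l. - R \<le> x $ l \<and> x $ l \<le> R" by (simp add: abs_le_iff minus_le_iff)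
    then have good: "x \<notin> slabs i (s j) (- (s j powr (1 + \<theta>))) (s j powr p + s j powr (1 + \<theta>))" for j
      using x(2) unfolding N_def M_def by blast
    let ?e = "(p - \<theta>) / (1 + \<theta>) + real (CARD('n) - 1)"
    have bound: "outer_measure_of lebesgue (ball x r - - A)
        \<le> ennreal (4 * 2 ^ (CARD('n) - 1) * \<eta> * r powr ?e)" if r: "0 < r" "r < 1" for r
    proof -
      have "ball x r - - A = (\<Union>j. ball x r \<inter> slabs i (s j) 0 (s j powr p))" by (auto simp: A_def)
      then have "outer_measure_of lebesgue (ball x r - - A)
          = emeasure lebesgue (\<Union>j. ball x r \<inter> slabs i (s j) 0 (s j powr p))"
        by (subst outer_measure_of_eq[symmetric]) (auto intro!: sets.countable_UN)
      also have "\<dots> \<le> (\<Sum>j. emeasure lebesgue (ball x r \<inter> slabs i (s j) 0 (s j powr p)))"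
        by (intro emeasure_subadditive_countably) auto
      also have "\<dots> \<le> (\<Sum>j. ennreal (4 * 2 ^ (CARD('n) - 1) * r powr ?e * s j powr \<theta>))"
        using s \<theta> r good by (intro suminf_le emeasure_ball_Int_slabs_le) auto
      also have "\<dots> = ennreal (4 * 2 ^ (CARD('n) - 1) * r powr ?e * \<eta>)"
        by (intro suminf_ennreal_eq sums_mult sum) auto
      finally show ?thesis by (simp add: mult_ac)
    qed
    show ?thesis
    proof (rule density_degree_between)
      show "x \<in> density_points (real CARD('n)) (- A)"
        using e ab by (intro density_pointsI[OF _ zero_less_one bound]) auto
      show "x \<in> density_points a (- A)" by (intro density_pointsI[OF e zero_less_one bound])
      fix m assume "b \<le> m"
      then show "x \<notin> density_points m (- A)"
        using \<theta> s(1,2) s0 A n1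
        by (intro not_density_points_slabs[where p = p and s = s and i = i]) (auto simp: p_def A_def)
    qed (use ab in auto)
  qed
  show ?thesis by (rule that[OF \<open>open A\<close> N N\<epsilon> deg])
qed

section \<open>Gluing finitely many local pictures\<close>

text \<open>
  Points strictly closer to \<open>K i\<close> than to every other set of the family form such neighbourhoods. Empty members are
  left out of the comparison because the distance to the empty set is \<open>0\<close> by convention.
\<close>

lemma disjoint_open_neighbourhoods:
  fixes K :: "'i \<Rightarrow> 'a::metric_space set"
  assumes "finite I" "\<And>i. i \<in> I \<Longrightarrow> closed (K i)" "disjoint_family_on K I"
  obtains V where "\<And>i. i \<in> I \<Longrightarrow> open (V i)" "\<And>i. i \<in> I \<Longrightarrow> K i \<subseteq> V i" "disjoint_family_on V I"
proof -
  define V where "V i = (if K i = {} then {} else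
      \<Inter>j\<in>{j\<in>I. K j \<noteq> {} \<and> j \<noteq> i}. {y. infdist y (K i) < infdist y (K j)})" for i
  have "open (V i)" if "i \<in> I" for i
    unfolding V_def using assms(1)
    by (auto intro!: open_INT open_Collect_less continuous_intros)
  moreover have "K i \<subseteq> V i" if "i \<in> I" for i
  proof
    fix x assume x: "x \<in> K i"
    have "infdist x (K i) < infdist x (K j)" if "j \<in> I" "K j \<noteq> {}" "j \<noteq> i" for j
    proof -
      have "x \<notin> K j" using x that \<open>i \<in> I\<close> assms(3) by (auto simp: disjoint_family_on_def)
      then show ?thesis using x that assms(2)
        by (metis infdist_zero in_closed_iff_infdist_zero infdist_nonneg order_le_less)
    qed
    then show "x \<in> V i" using x by (auto simp: V_def)
  qed
  moreover have "disjoint_family_on V I"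
    unfolding disjoint_family_on_def V_def by (force split: if_splits)
  ultimately show ?thesis using that by blast
qed

text \<open>
  Inner regularity replaces each \<open>E i\<close> by a closed subset \<open>K i\<close>. On a neighbourhood \<open>V i\<close> of \<open>K i\<close>
  that is disjoint from the other neighbourhoods, \<open>F\<close> agrees with the complement of \<open>A i\<close>, and the degree is local.
\<close>

lemma glue_closed_set:
  fixes A :: "'i \<Rightarrow> (real ^ 'n::finite) set"
  assumes I: "finite I" and E: "\<And>i. i \<in> I \<Longrightarrow> E i \<in> sets lebesgue" "disjoint_family_on E I"
    and A: "\<And>i. i \<in> I \<Longrightarrow> open (A i)" and "0 < \<epsilon>"
  obtains F N where "closed F" "N \<in> sets lebesgue" "emeasure lebesgue N \<le> ennreal \<epsilon>"
    "\<And>i x. i \<in> I \<Longrightarrow> x \<in> E i - N \<Longrightarrow> density_degree F x = density_degree (- A i) x"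
proof -
  define \<delta> where "\<delta> = \<epsilon> / (real (card I) + 1)"
  have \<delta>: "0 < \<delta>" "real (card I) * \<delta> \<le> \<epsilon>" using \<open>0 < \<epsilon>\<close> unfolding \<delta>_def by (auto simp: field_simps)
  have "\<exists>T. closed T \<and> T \<subseteq> E i \<and> E i - T \<in> sets lebesgue \<and> emeasure lebesgue (E i - T) \<le> ennreal \<delta>"
    if "i \<in> I" for i
    using sets_lebesgue_inner_closed[OF E(1)[OF that] \<delta>(1)] by (metis fmeasurableD less_imp_le)
  then obtain K where K: "\<And>i. i \<in> I \<Longrightarrow> closed (K i)" "\<And>i. i \<in> I \<Longrightarrow> K i \<subseteq> E i"
    "\<And>i. i \<in> I \<Longrightarrow> E i - K i \<in> sets lebesgue"
    "\<And>i. i \<in> I \<Longrightarrow> emeasure lebesgue (E i - K i) \<le> ennreal \<delta>" by metis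
  have "disjoint_family_on K I" using E(2) K(2) by (fastforce simp: disjoint_family_on_def)
  from disjoint_open_neighbourhoods[OF I K(1) this] obtain V where V:
    "\<And>i. i \<in> I \<Longrightarrow> open (V i)" "\<And>i. i \<in> I \<Longrightarrow> K i \<subseteq> V i"
    "disjoint_family_on V I" by blast
  define F where "F = - (\<Union>i\<in>I. V i \<inter> A i)"
  define N where "N = (\<Union>i\<in>I. E i - K i)"
  have "closed F" unfolding F_def using V(1) A by (intro closed_Compl open_UN ballI open_Int)
  moreover have "N \<in> sets lebesgue" unfolding N_def using I K(3) by (intro sets.finite_UN) auto
  moreover have "emeasure lebesgue N \<le> ennreal \<epsilon>"
  proof -
    have "emeasure lebesgue N \<le> (\<Sum>i\<in>I. emeasure lebesgue (E i - K i))"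
      unfolding N_def using I K(3) by (intro emeasure_subadditive_finite) auto
    also have "\<dots> \<le> (\<Sum>i\<in>I. ennreal \<delta>)" by (intro sum_mono K)
    also have "\<dots> = ennreal (real (card I) * \<delta>)" using \<delta> by (subst sum_ennreal) auto
    also have "\<dots> \<le> ennreal \<epsilon>" using \<delta> by (intro ennreal_leI)
    finally show ?thesis .
  qed
  moreover have "density_degree F x = density_degree (- A i) x" if "i \<in> I" "x \<in> E i - N" for i x
  proof (rule density_degree_local)
    show "open (V i)" using V that by auto
    have "x \<in> K i" using that unfolding N_def by auto
    then show "x \<in> V i" using V that by auto
    have "j = i" if "j \<in> I" "y \<in> V j" "y \<in> V i" for j y
      using disjoint_family_onD[OF V(3) \<open>j \<in> I\<close> \<open>i \<in> I\<close>] that by auto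
    then show "V i - F = V i - - A i" using \<open>i \<in> I\<close> unfolding F_def by auto
  qed
  ultimately show ?thesis using that by blast
qed

section \<open>Approximation of a measurable function\<close>

text \<open>
  Class \<open>0\<close> collects the points where \<open>f\<close> is below the dimension, and class \<open>j > 0\<close> those where the truncated
  function lies in \<open>[n + (j - 1) / k, n + j / k)\<close>. The degree on class \<open>j\<close> is placed one step
  higher, in \<open>[n + j / k, n + (j + 1) / k]\<close>, because degrees strictly above the dimension are the ones that slabs produce.
\<close>

lemma closed_set_approximating_degree:
  fixes f :: "real ^ 'n::finite \<Rightarrow> ereal" and k :: nat
  assumes f [measurable]: "f \<in> borel_measurable lebesgue" and k: "0 < k" and \<epsilon>: "0 < \<epsilon>"
  obtains F N where "closed F" "N \<in> sets lebesgue" "emeasure lebesgue N \<le> ennreal \<epsilon>"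
    "\<And>x. norm x \<le> real k \<Longrightarrow> x \<notin> N \<Longrightarrow> f x < ereal (real CARD('n)) \<Longrightarrow> density_degree F x = 0"
    "\<And>x. norm x \<le> real k \<Longrightarrow> x \<notin> N \<Longrightarrow> ereal (real CARD('n)) \<le> f x \<Longrightarrow>
       min (f x) (ereal (real CARD('n) + real k)) \<le> density_degree F x \<and>
       density_degree F x \<le> min (f x) (ereal (real CARD('n) + real k)) + ereal (2 / real k)"
proof -
  define n where "n = real CARD('n)"
  have n: "0 < n" by (simp add: n_def)
  define g where "g x = real_of_ereal (min (f x) (ereal (n + real k)))" for x
  define h where "h x = (if f x < ereal n then 0 else Suc (nat \<lfloor>real k * (g x - n)\<rfloor>))" for x
  define E where "E j = {x. h x = j}" for j
  define I where "I = {..Suc (k * k)}"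
  define \<delta> where "\<delta> = \<epsilon> / (2 * (real (card I)))"
  have I: "finite I" "0 < card I" by (auto simp: I_def)
  have \<delta>: "0 < \<delta>" "real (card I) * \<delta> = \<epsilon> / 2" using \<epsilon> I by (auto simp: \<delta>_def)
  have g: "ereal (g x) = min (f x) (ereal (n + real k))" if "ereal n \<le> f x" for x
    using that unfolding g_def by (cases "f x") (auto simp: min_def)
  have h: "h x \<in> I" "n + real (h x) / real k \<ge> g x" "n + (real (h x) + 1) / real k \<le> g x + 2 / real k" "0 < h x"
    if "ereal n \<le> f x" for x
  proof -
    define t where "t = real k * (g x - n)"
    have "ereal n \<le> ereal (g x)" "ereal (g x) \<le> ereal (n + real k)" unfolding g[OF that] using that by auto
    then have gx: "n \<le> g x" "g x \<le> n + real k" by auto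
    have hx: "h x = Suc (nat \<lfloor>t\<rfloor>)" using that by (simp add: h_def t_def)
    have t: "0 \<le> t" "t \<le> real k * real k" using gx unfolding t_def by (auto intro!: mult_left_mono)
    have gt: "g x = n + t / real k" using k by (simp add: t_def)
    have fl: "real (nat \<lfloor>t\<rfloor>) \<le> t" "t \<le> real (nat \<lfloor>t\<rfloor>) + 1" using t by linarith+
    have "real (nat \<lfloor>t\<rfloor>) \<le> real (k * k)" using fl(1) t(2) unfolding of_nat_mult by linarith
    then have "nat \<lfloor>t\<rfloor> \<le> k * k" by (simp only: of_nat_le_iff)
    then show "h x \<in> I" by (simp add: hx I_def)
    have "t / real k \<le> (real (nat \<lfloor>t\<rfloor>) + 1) / real k" using fl by (intro divide_right_mono) auto
    then show "n + real (h x) / real k \<ge> g x" unfolding gt hx by (simp add: add.commute)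
    have "(real (nat \<lfloor>t\<rfloor>) + 2) / real k \<le> (t + 2) / real k" using fl by (intro divide_right_mono) auto
    then show "n + (real (h x) + 1) / real k \<le> g x + 2 / real k" unfolding gt hx
      by (simp add: add_divide_distrib)
    show "0 < h x" by (simp add: hx)
  qed
  define P where "P j A x \<longleftrightarrow>
     (if j = 0 then density_degree (- A) x = 0
      else ereal (n + real j / real k) \<le> density_degree (- A) x \<and>
           density_degree (- A) x \<le> ereal (n + (real j + 1) / real k))"
    for j and A :: "(real ^ 'n) set" and x
  have "\<exists>A N. open A \<and> N \<in> sets lebesgue \<and> emeasure lebesgue N \<le> ennreal \<delta> \<and>
     (\<forall>x. norm x \<le> real k \<longrightarrow> x \<notin> N \<longrightarrow> P j A x)" for j
  proof (cases "j = 0")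
    case True
    then show ?thesis
      using density_degree_empty by (intro exI[of _ UNIV] exI[of _ "{}"]) (auto simp: P_def)
  next
    case False
    have "n < n + real j / real k" "n + real j / real k < n + (real j + 1) / real k" "0 < real k"
      using False k by (auto intro: divide_strict_right_mono)
    note * = open_set_with_prescribed_degree[OF this[unfolded n_def] \<delta>(1), folded n_def]
    obtain A N :: "(real ^ 'n) set" where "open A" "N \<in> sets lebesgue" "emeasure lebesgue N \<le> ennreal \<delta>"
      "\<And>x. norm x \<le> real k \<Longrightarrow> x \<notin> N \<Longrightarrow> ereal (n + real j / real k) \<le> density_degree (- A) x \<and>
              density_degree (- A) x \<le> ereal (n + (real j + 1) / real k)"
      by (rule *) (rule that; (assumption | blast))
    then show ?thesis using False by (intro exI[of _ A] exI[of _ N]) (simp add: P_def)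
  qed
  then obtain A M where AM: "\<And>j. open (A j)" "\<And>j. M j \<in> sets lebesgue"
    "\<And>j. emeasure lebesgue (M j) \<le> ennreal \<delta>"
    "\<And>j x. norm x \<le> real k \<Longrightarrow> x \<notin> M j \<Longrightarrow> P j (A j) x" by metis
  have hm: "h \<in> lebesgue \<rightarrow>\<^sub>M count_space UNIV" unfolding h_def g_def by measurable
  have E: "E j \<in> sets lebesgue" for j
    using measurable_sets[OF hm, of "{j}"] by (simp add: E_def vimage_def)
  have "disjoint_family_on E I" by (auto simp: disjoint_family_on_def E_def)
  note * = glue_closed_set[where E = E and A = A, OF I(1) E this AM(1) half_gt_zero[OF \<epsilon>]]
  obtain F N0 where F: "closed F" "N0 \<in> sets lebesgue" "emeasure lebesgue N0 \<le> ennreal (\<epsilon> / 2)"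
    "\<And>j x. j \<in> I \<Longrightarrow> x \<in> E j - N0 \<Longrightarrow> density_degree F x = density_degree (- A j) x"
    by (rule *) (rule that; (assumption | blast))
  define N where "N = N0 \<union> (\<Union>j\<in>I. M j)"
  have UM: "(\<Union>j\<in>I. M j) \<in> sets lebesgue" using AM(2) I by (intro sets.finite_UN) auto
  then have N: "N \<in> sets lebesgue" unfolding N_def using F(2) by auto
  have N\<epsilon>: "emeasure lebesgue N \<le> ennreal \<epsilon>"
  proof -
    have "emeasure lebesgue (\<Union>j\<in>I. M j) \<le> (\<Sum>j\<in>I. emeasure lebesgue (M j))"
      using I AM(2) by (intro emeasure_subadditive_finite) auto
    also have "\<dots> \<le> (\<Sum>j\<in>I. ennreal \<delta>)" by (intro sum_mono AM)
    also have "\<dots> = ennreal (\<epsilon> / 2)" using \<delta> by (subst sum_ennreal) auto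
    finally have M2: "emeasure lebesgue (\<Union>j\<in>I. M j) \<le> ennreal (\<epsilon> / 2)" .
    have "emeasure lebesgue N \<le> emeasure lebesgue N0 + emeasure lebesgue (\<Union>j\<in>I. M j)"
      unfolding N_def by (intro emeasure_subadditive F UM)
    also have "\<dots> \<le> ennreal (\<epsilon> / 2) + ennreal (\<epsilon> / 2)" by (intro add_mono F M2)
    also have "\<dots> = ennreal \<epsilon>" using \<epsilon> by (simp add: ennreal_plus[symmetric] del: ennreal_plus)
    finally show ?thesis .
  qed
  have deg: "density_degree F x = density_degree (- A (h x)) x" "x \<notin> M (h x)"
    if "x \<notin> N" "h x \<in> I" for x
    using F(4)[of "h x" x] that by (auto simp: N_def E_def)
  show ?thesis
  proof (rule that[OF F(1) N N\<epsilon>], unfold n_def[symmetric])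
    fix x assume x: "norm x \<le> real k" "x \<notin> N" "f x < ereal n"
    then have "h x = 0" by (simp add: h_def)
    then show "density_degree F x = 0" using deg[of x] x AM(4)[of x 0] by (simp add: I_def P_def)
  next
    fix x assume x: "norm x \<le> real k" "x \<notin> N" "ereal n \<le> f x"
    note hx = h[OF x(3)]
    have "ereal (n + real (h x) / real k) \<le> density_degree F x \<and>
              density_degree F x \<le> ereal (n + (real (h x) + 1) / real k)"
      using AM(4)[of x "h x"] deg[OF x(2) hx(1)] x(1) hx(4) by (simp add: P_def)
    moreover have "ereal (g x) \<le> ereal (n + real (h x) / real k)"
      "ereal (n + (real (h x) + 1) / real k) \<le> ereal (g x) + ereal (2 / real k)"
      using hx by auto
    ultimately show "min (f x) (ereal (n + real k)) \<le> density_degree F x \<and>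
       density_degree F x \<le> min (f x) (ereal (n + real k)) + ereal (2 / real k)"
      unfolding g[OF x(3), symmetric] by (meson order_trans)
  qed
qed

theorem theorem5p1:
  fixes f :: "real ^ 'n::finite \<Rightarrow> ereal"
  assumes "f \<in> borel_measurable lebesgue"
    and "AE x in lebesgue. f x \<in> {0} \<union> {ereal (real CARD('n))..\<infinity>}"
  shows "\<exists>F :: nat \<Rightarrow> (real ^ 'n) set.
           (\<forall>k. closed (F k)) \<and>
           (AE x in lebesgue. (\<lambda>k. density_degree (F k) x) \<longlonglongrightarrow> f x)"
proof -
  let ?n = "real CARD('n)"
  \<comment> \<open>The \<open>k\<close>-th set uses truncation and step size for \<open>Suc k\<close>, which is positive.\<close>
  let ?m = "\<lambda>k x. min (f x) (ereal (?n + real (Suc k)))"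
  define P where "P k F x \<longleftrightarrow>
      (f x < ereal ?n \<longrightarrow> density_degree F x = 0) \<and>
      (ereal ?n \<le> f x \<longrightarrow> ?m k x \<le> density_degree F x \<and>
        density_degree F x \<le> ?m k x + ereal (2 / real (Suc k)))"
    for k and F :: "(real ^ 'n) set" and x
  have "\<exists>F N. closed F \<and> N \<in> sets lebesgue \<and> emeasure lebesgue N \<le> ennreal ((1 / 2) ^ k) \<and>
      (\<forall>x. norm x \<le> real (Suc k) \<longrightarrow> x \<notin> N \<longrightarrow> P k F x)" for k
  proof -
    have "0 < Suc k" "0 < (1 / 2 :: real) ^ k" by simp_all
    note * = closed_set_approximating_degree[OF assms(1) this]
    obtain F N where "closed F" "N \<in> sets lebesgue" "emeasure lebesgue N \<le> ennreal ((1 / 2) ^ k)"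
      "\<And>x. norm x \<le> real (Suc k) \<Longrightarrow> x \<notin> N \<Longrightarrow> f x < ereal ?n \<Longrightarrow> density_degree F x = 0"
      "\<And>x. norm x \<le> real (Suc k) \<Longrightarrow> x \<notin> N \<Longrightarrow> ereal ?n \<le> f x \<Longrightarrow> ?m k x \<le> density_degree F x \<and>
        density_degree F x \<le> ?m k x + ereal (2 / real (Suc k))" by (rule *) (rule that; (assumption | blast))
    then show ?thesis unfolding P_def by (intro exI[of _ F] exI[of _ N]) simp
  qed
  then obtain F N where F: "\<And>k. closed (F k)" and N: "\<And>k. N k \<in> sets lebesgue"
      "\<And>k. emeasure lebesgue (N k) \<le> ennreal ((1 / 2) ^ k)"
    and P: "\<And>k x. norm x \<le> real (Suc k) \<Longrightarrow> x \<notin> N k \<Longrightarrow> P k (F k) x" by metis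
  have "measure lebesgue (N k) \<le> (1 / 2) ^ k" for k
    unfolding measure_def using N(2)[of k] by (intro enn2real_leI) auto
  then have "summable (\<lambda>k. measure lebesgue (N k))"
    by (intro summable_comparison_test'[OF summable_geometric[of "1 / 2 :: real"]]) auto
  moreover have "emeasure lebesgue (N k) < \<infinity>" for k
    using N(2)[of k] by (simp add: order_le_less_trans[OF _ ennreal_less_top])
  ultimately have "AE x in lebesgue. \<forall>\<^sub>F k in sequentially. x \<in> space lebesgue - N k"
    using N(1) by (intro borel_cantelli_AE1)
  with assms(2) have "AE x in lebesgue. (\<lambda>k. density_degree (F k) x) \<longlonglongrightarrow> f x"
  proof eventually_elim
    case (elim x)
    have "\<forall>\<^sub>F k in sequentially. norm x \<le> real (Suc k)"
    proof -
      obtain k0 where "norm x \<le> real k0" using real_arch_simple by blast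
      then show ?thesis by (intro eventually_sequentiallyI[of k0]) simp
    qed
    with elim(2) have ev: "\<forall>\<^sub>F k in sequentially. norm x \<le> real (Suc k) \<and> x \<notin> N k"
      by eventually_elim simp
    consider "f x = 0" | "ereal ?n \<le> f x" using elim(1) by auto
    then show ?case
    proof cases
      case 1
      have "\<forall>\<^sub>F k in sequentially. density_degree (F k) x = f x"
        using ev by eventually_elim (use 1 P in \<open>auto simp: P_def\<close>)
      then show ?thesis by (rule tendsto_eventually)
    next
      case 2
      have "filterlim (\<lambda>k. ?n + real (Suc k)) at_top sequentially"
        by (intro filterlim_tendsto_add_at_top[OF tendsto_const]
            filterlim_compose[OF filterlim_real_sequentially filterlim_Suc])
      then have "(\<lambda>k. ereal (?n + real (Suc k))) \<longlonglongrightarrow> \<infinity>" by (simp add: tendsto_PInfty_eq_at_top)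
      from tendsto_min[OF tendsto_const this]
      have low: "(\<lambda>k. ?m k x) \<longlonglongrightarrow> f x" by (simp add: min_def)
      have "(\<lambda>k. 2 / real (Suc k)) \<longlonglongrightarrow> 0"
        using tendsto_mult_right_zero[OF LIMSEQ_inverse_real_of_nat, of 2] by (simp add: divide_inverse)
      then have "(\<lambda>k. ereal (2 / real (Suc k))) \<longlonglongrightarrow> 0" by (simp add: zero_ereal_def)
      from tendsto_add_ereal_general1[OF _ low this]
      have up: "(\<lambda>k. ?m k x + ereal (2 / real (Suc k))) \<longlonglongrightarrow> f x" by simp
      show ?thesis
      proof (rule tendsto_sandwich[OF _ _ low up])
        show "\<forall>\<^sub>F k in sequentially. ?m k x \<le> density_degree (F k) x"
          using ev by eventually_elim (use 2 P in \<open>auto simp: P_def\<close>)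
        show "\<forall>\<^sub>F k in sequentially. density_degree (F k) x \<le> ?m k x + ereal (2 / real (Suc k))"
          using ev by eventually_elim (use 2 P in \<open>auto simp: P_def\<close>)
      qed
    qed
  qed
  with F show ?thesis by blast
qed

end
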